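(* Let $\mathcal{K}$ be a finite oriented simplicial complex of dimension $K$ with positive weights $w:\mathcal{K}\to(0,\infty)$, let $0\le k\le K$, and let $s^k\in C_k(\mathcal{K},\mathbb{R})\cong\mathbb{R}^{D_k}$. For $s^{k-1}\in\mathbb{R}^{D_{k-1}}$ and $s^{k+1}\in\mathbb{R}^{D_{k+1}}$, the following are equivalent: (1) There exists $s^k_H\in\mathrm{Ker}(L_k)$ such that $$s^k=B_k^Ts^{k-1}+s^k_H+W_k^{-1}B_{k+1}W_{k+1}s^{k+1}.$$ (2) The pair $(\alpha,\beta)=(s^{k-1},s^{k+1})$ is a solution of the equations $$L_{k-1}^{\mathrm{u}}\alpha=W_{k-1}^{-1}B_kW_ks^k,\qquad L_{k+1}^{\mathrm{d}}\beta=B_{k+1}^Ts^k.$$ (3) The pair $(\alpha,\beta)=(s^{k-1},s^{k+1})$ is a solution (i.e. $\alpha$ and $\beta$ are minimizers, respectively) of the pair of least squares problems $$\min_{\alpha\in\mathbb{R}^{D_{k-1}}}\ \|\partial_k^\dagger\alpha-s^k\|_{W_k}^2,\qquad \min_{\beta\in\mathbb{R}^{D_{k+1}}}\ \|\partial_{k+1}\beta-s^k\|_{W_k}^2,$$ where $\partial_k^\dagger=B_k^T$, $\partial_{k+1}=W_k^{-1}B_{k+1}W_{k+1}$, and $\|f\|_{W_k}^2=f^TW_kf$.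
   Context: A (finite abstract) simplicial complex $\mathcal{K}$ is a finite collection of finite nonempty vertex sets closed under taking nonempty subsets; a $k$-simplex is an element with $k+1$ vertices, and the dimension $K$ is the largest order $k$ of a simplex. Each simplex carries a fixed orientation (an ordering of its vertices up to even permutation; vertices have the trivial orientation). $D_k$ is the number of $k$-simplices, and $C_k(\mathcal{K},\mathbb{R})\cong\mathbb{R}^{D_k}$ is the space of real linear combinations of oriented $k$-simplices. For $1\le k\le K$, the incidence matrix $B_k\in\mathbb{R}^{D_{k-1}\times D_k}$ is the matrix of the unweighted boundary operator $[v_{i_0},\dots,v_{i_k}]\mapsto\sum_{j=0}^k(-1)^j[v_{i_0},\dots,v_{i_k}]\setminus[v_{i_j}]$ in the bases of oriented simplices: its $(i,j)$ entry is $0$ if the $(k-1)$-simplex $\sigma_i^{k-1}$ is not a face of $\sigma_j^k$, and otherwise $1$ or $-1$ according to whether the orientations of $\sigma_i^{k-1}$ and $\sigma_j^k$ are coherent or not. One has $B_kB_{k+1}=0$. $W_k\in\mathbb{R}^{D_k\times D_k}$ is the diagonal matrix of the (positive) weights of the $k$-simplices. The weighted down, up and Hodge Laplacians are $L_k^{\mathrm{d}}=B_k^TW_{k-1}^{-1}B_kW_k$, $L_k^{\mathrm{u}}=W_k^{-1}B_{k+1}W_{k+1}B_{k+1}^T$, and $L_k=L_k^{\mathrm{u}}+L_k^{\mathrm{d}}$. Conventions: there are no simplices of order $-1$ or $K+1$, i.e. $D_{-1}=D_{K+1}=0$, so the terms and equations involving $B_0$ and $B_{K+1}$ are trivial. 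*)

theory Defs
  imports "Jordan_Normal_Form.Matrix_Kernel" "HOL-Combinatorics.Permutations"
begin

text \<open>
  Orders are integers, so that the conventions at both ends of the complex need no case
  distinction: no simplex has order \<open>-1\<close> or \<open>K + 1\<close>, and the corresponding matrices have no rows
  or no columns.

  An orientation is given by a representative ordering of the vertices of each simplex, and the
  identification of the \<open>k\<close>-chains with \<open>D\<^sub>k\<close>-dimensional vectors by an arbitrary numbering
  \<open>nth_simplex k 0, nth_simplex k 1, \<dots>\<close> of the \<open>k\<close>-simplices.
\<close>

record 'a weighted_complex =
  complex :: "'a set set"
  orient :: "'a set \<Rightarrow> 'a list"
  weight :: "'a set \<Rightarrow> real"
  nth_simplex :: "int \<Rightarrow> nat \<Rightarrow> 'a set"

definition simplicial_complex :: "'a set set \<Rightarrow> bool" where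
  "simplicial_complex \<K> \<longleftrightarrow> finite \<K> \<and>
    (\<forall>\<sigma>\<in>\<K>. finite \<sigma> \<and> \<sigma> \<noteq> {} \<and> (\<forall>\<tau>\<subseteq>\<sigma>. \<tau> \<noteq> {} \<longrightarrow> \<tau> \<in> \<K>))"

definition simplex_order :: "'a set \<Rightarrow> int" where
  "simplex_order \<sigma> = int (card \<sigma>) - 1"

definition simplices :: "'a weighted_complex \<Rightarrow> int \<Rightarrow> 'a set set" where
  "simplices X k = {\<sigma> \<in> complex X. simplex_order \<sigma> = k}"

definition num_simplices :: "'a weighted_complex \<Rightarrow> int \<Rightarrow> nat" where
  "num_simplices X k = card (simplices X k)"

text \<open>The element \<open>-1\<close> only matters for the empty complex.\<close>

definition complex_dim :: "'a weighted_complex \<Rightarrow> int" where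
  "complex_dim X = Max (insert (- 1) (simplex_order ` complex X))"

definition oriented_weighted_complex :: "'a weighted_complex \<Rightarrow> bool" where
  "oriented_weighted_complex X \<longleftrightarrow> simplicial_complex (complex X) \<and>
    (\<forall>\<sigma>\<in>complex X. distinct (orient X \<sigma>) \<and> set (orient X \<sigma>) = \<sigma>) \<and>
    (\<forall>\<sigma>\<in>complex X. weight X \<sigma> > 0) \<and>
    (\<forall>k. bij_betw (nth_simplex X k) {..<num_simplices X k} (simplices X k))"

definition same_orientation :: "'a list \<Rightarrow> 'a list \<Rightarrow> bool" where
  "same_orientation xs ys \<longleftrightarrow>
    (\<exists>p. p permutes {..<length xs} \<and> evenperm p \<and> permute_list p xs = ys)"

text \<open>
  The coordinate of the oriented simplex \<open>[ys]\<close>, whose vertices \<open>ys\<close> are distinct, with respect to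
  the basis vector \<open>\<sigma>\<close>; an odd permutation of the vertices changes the sign.
\<close>

definition simplex_coord :: "'a weighted_complex \<Rightarrow> 'a list \<Rightarrow> 'a set \<Rightarrow> real" where
  "simplex_coord X ys \<sigma> =
    (if set ys \<noteq> \<sigma> then 0 else if same_orientation (orient X \<sigma>) ys then 1 else - 1)"

definition delete_nth :: "nat \<Rightarrow> 'a list \<Rightarrow> 'a list" where
  "delete_nth j xs = take j xs @ drop (Suc j) xs"

text \<open>
  The coefficient of \<open>\<sigma>\<close> in the boundary
  \<open>\<Sum>j. (-1) ^ j [v\<^sub>0, \<dots>, v\<^sub>j\<^sub>-\<^sub>1, v\<^sub>j\<^sub>+\<^sub>1, \<dots>, v\<^sub>k]\<close> of \<open>\<tau> = [v\<^sub>0, \<dots>, v\<^sub>k]\<close>.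
\<close>

definition boundary_coeff :: "'a weighted_complex \<Rightarrow> 'a set \<Rightarrow> 'a set \<Rightarrow> real" where
  "boundary_coeff X \<sigma> \<tau> =
    (\<Sum>j<length (orient X \<tau>). (- 1) ^ j * simplex_coord X (delete_nth j (orient X \<tau>)) \<sigma>)"

definition incidence_mat :: "'a weighted_complex \<Rightarrow> int \<Rightarrow> real mat" where
  "incidence_mat X k = mat (num_simplices X (k - 1)) (num_simplices X k)
    (\<lambda>(i, j). boundary_coeff X (nth_simplex X (k - 1) i) (nth_simplex X k j))"

definition weight_mat :: "'a weighted_complex \<Rightarrow> int \<Rightarrow> real mat" where
  "weight_mat X k = mat_diag (num_simplices X k) (\<lambda>i. weight X (nth_simplex X k i))"

definition weight_mat_inv :: "'a weighted_complex \<Rightarrow> int \<Rightarrow> real mat" where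
  "weight_mat_inv X k = mat_diag (num_simplices X k) (\<lambda>i. inverse (weight X (nth_simplex X k i)))"

definition down_laplacian :: "'a weighted_complex \<Rightarrow> int \<Rightarrow> real mat" where
  "down_laplacian X k =
    (incidence_mat X k)\<^sup>T * weight_mat_inv X (k - 1) * incidence_mat X k * weight_mat X k"

definition up_laplacian :: "'a weighted_complex \<Rightarrow> int \<Rightarrow> real mat" where
  "up_laplacian X k =
    weight_mat_inv X k * incidence_mat X (k + 1) * weight_mat X (k + 1) * (incidence_mat X (k + 1))\<^sup>T"

definition hodge_laplacian :: "'a weighted_complex \<Rightarrow> int \<Rightarrow> real mat" where
  "hodge_laplacian X k = up_laplacian X k + down_laplacian X k"

text \<open>The weighted coboundary operator on \<open>(k - 1)\<close>-chains and boundary operator on \<open>k\<close>-chains.\<close>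

definition coboundary_mat :: "'a weighted_complex \<Rightarrow> int \<Rightarrow> real mat" where
  "coboundary_mat X k = (incidence_mat X k)\<^sup>T"

definition boundary_mat :: "'a weighted_complex \<Rightarrow> int \<Rightarrow> real mat" where
  "boundary_mat X k = weight_mat_inv X (k - 1) * incidence_mat X k * weight_mat X k"

definition weighted_sqnorm :: "'a weighted_complex \<Rightarrow> int \<Rightarrow> real vec \<Rightarrow> real" where
  "weighted_sqnorm X k f = f \<bullet> (weight_mat X k *\<^sub>v f)"

lemma weight_mat_inverse:
  assumes "oriented_weighted_complex X"
  shows "weight_mat_inv X k * weight_mat X k = 1\<^sub>m (num_simplices X k)"
    and "weight_mat X k * weight_mat_inv X k = 1\<^sub>m (num_simplices X k)"
proof -
  have "weight X (nth_simplex X k i) \<noteq> 0" if "i < num_simplices X k" for i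
  proof -
    have "nth_simplex X k i \<in> complex X"
      using assms that
      unfolding oriented_weighted_complex_def simplices_def bij_betw_def by blast
    then show ?thesis
      using assms unfolding oriented_weighted_complex_def by force
  qed
  then show "weight_mat_inv X k * weight_mat X k = 1\<^sub>m (num_simplices X k)"
    and "weight_mat X k * weight_mat_inv X k = 1\<^sub>m (num_simplices X k)"
    unfolding weight_mat_def weight_mat_inv_def mat_diag_diag
    by (auto intro!: eq_matI simp: mat_diag_def)
qed

lemma set_delete_nth:
  assumes "distinct xs" "j < length xs"
  shows "set (delete_nth j xs) = set xs - {xs ! j}"
proof -
  have "xs = take j xs @ xs ! j # drop (Suc j) xs"
    using assms(2) by (simp add: id_take_nth_drop)
  then obtain us vs where *: "us = take j xs" "vs = drop (Suc j) xs" "xs = us @ xs ! j # vs"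
    by blast
  with assms(1) have "distinct (us @ xs ! j # vs)" by metis
  moreover have "set xs = set (us @ xs ! j # vs)" using *(3) by metis
  ultimately show ?thesis
    unfolding delete_nth_def *(1,2)[symmetric] by auto
qed

text \<open>
  The entries of the incidence matrices: \<open>0\<close> off the faces; on a face, \<open>1\<close> if its orientation is
  the one induced by the larger simplex, and \<open>-1\<close> otherwise.
\<close>

lemma boundary_coeff_face:
  assumes "distinct (orient X \<tau>)" "set (orient X \<tau>) = \<tau>" "j < length (orient X \<tau>)"
  shows "boundary_coeff X (\<tau> - {orient X \<tau> ! j}) \<tau> =
    (if even j \<longleftrightarrow>
        same_orientation (orient X (\<tau> - {orient X \<tau> ! j})) (delete_nth j (orient X \<tau>))
     then 1 else - 1)"
proof -
  let ?xs = "orient X \<tau>" and ?\<sigma> = "\<tau> - {orient X \<tau> ! j}"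
  have "simplex_coord X (delete_nth i ?xs) ?\<sigma> = 0" if "i < length ?xs" "i \<noteq> j" for i
  proof -
    have "?xs ! i \<noteq> ?xs ! j" "?xs ! j \<in> \<tau>" "?xs ! i \<in> \<tau>"
      using assms that nth_eq_iff_index_eq nth_mem by metis+
    then show ?thesis
      using set_delete_nth[OF assms(1) that(1)] assms(2) by (auto simp: simplex_coord_def)
  qed
  then have "boundary_coeff X ?\<sigma> \<tau> =
      (\<Sum>i<length ?xs. if i = j then (- 1) ^ j * simplex_coord X (delete_nth j ?xs) ?\<sigma> else 0)"
    unfolding boundary_coeff_def by (intro sum.cong) auto
  also have "\<dots> = (- 1) ^ j * simplex_coord X (delete_nth j ?xs) ?\<sigma>"
    using assms(3) by simp
  finally show ?thesis
    using set_delete_nth[OF assms(1,3)] assms(2) by (auto simp: simplex_coord_def)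
qed

lemma boundary_coeff_not_face:
  assumes "distinct (orient X \<tau>)" "set (orient X \<tau>) = \<tau>" "\<And>v. v \<in> \<tau> \<Longrightarrow> \<sigma> \<noteq> \<tau> - {v}"
  shows "boundary_coeff X \<sigma> \<tau> = 0"
  unfolding boundary_coeff_def
proof (intro sum.neutral ballI)
  fix j assume "j \<in> {..<length (orient X \<tau>)}"
  then have j: "j < length (orient X \<tau>)" by simp
  then have "orient X \<tau> ! j \<in> \<tau>" using assms(2) nth_mem by metis
  then show "(- 1) ^ j * simplex_coord X (delete_nth j (orient X \<tau>)) \<sigma> = 0"
    using set_delete_nth[OF assms(1) j] assms(2,3) by (auto simp: simplex_coord_def)
qed

end

theory Submission
  imports Defs
begin

text \<open>
  Since \<open>B\<^sub>k B\<^sub>k\<^sub>+\<^sub>1 = 0\<close>, the images of \<open>B\<^sub>k\<^sup>T\<close> and of \<open>W\<^sub>k\<inverse> B\<^sub>k\<^sub>+\<^sub>1 W\<^sub>k\<^sub>+\<^sub>1\<close> are orthogonal in the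
  inner product given by \<open>W\<^sub>k\<close>, and the kernel of \<open>L\<^sub>k\<close> is the orthogonal complement of their sum.
  So the remainder \<open>s\<^sup>k - B\<^sub>k\<^sup>T \<alpha> - W\<^sub>k\<inverse> B\<^sub>k\<^sub>+\<^sub>1 W\<^sub>k\<^sub>+\<^sub>1 \<beta>\<close> is harmonic if and only if
  \<open>s\<^sup>k - B\<^sub>k\<^sup>T \<alpha>\<close> is orthogonal to the first image and \<open>s\<^sup>k - W\<^sub>k\<inverse> B\<^sub>k\<^sub>+\<^sub>1 W\<^sub>k\<^sub>+\<^sub>1 \<beta>\<close> to the second.
  These two conditions are equivalent to the equations in (2), and they are the normal equations of
  the least squares problems in (3).
\<close>

subsection \<open>The boundary of a boundary\<close>

text \<open>
  The sum \<open>\<Sum>j. (-1) ^ j * f (delete_nth j xs)\<close>. In this recursive form, applying it twice gives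
  \<open>0\<close> by a plain induction, without rearranging a double sum.
\<close>

primrec alt_sum :: "('a list \<Rightarrow> real) \<Rightarrow> 'a list \<Rightarrow> real" where
  "alt_sum f [] = 0"
| "alt_sum f (x # xs) = f xs - alt_sum (\<lambda>ys. f (x # ys)) xs"

lemma alt_sum_eq_sum: "alt_sum f xs = (\<Sum>j<length xs. (- 1) ^ j * f (delete_nth j xs))"
proof (induction xs arbitrary: f)
  case (Cons x xs)
  show ?case
    by (simp add: Cons.IH sum.lessThan_Suc_shift delete_nth_def sum_negf del: sum.lessThan_Suc)
qed simp

lemma alt_sum_diff: "alt_sum (\<lambda>ys. f ys - g ys) xs = alt_sum f xs - alt_sum g xs"
  by (induction xs arbitrary: f g) simp_all

text \<open>For a list \<open>x # xs\<close>, the inner sum at \<open>x # ys\<close> is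
  \<open>f ys\<close> minus an alternating sum over \<open>ys\<close>. The resulting two copies of
  \<open>alt_sum f xs\<close> cancel, leaving the induction hypothesis for
  \<open>\<lambda>ys. f (x # ys)\<close>.\<close>

lemma alt_sum_alt_sum: "alt_sum (alt_sum f) xs = 0"
  by (induction xs arbitrary: f) (simp_all add: alt_sum_diff)

text \<open>
  Restricted to distinct lists because \<^const>\<open>simplex_coord\<close> is constantly \<open>-1\<close> on non-distinct
  lists with vertex set \<open>\<sigma>\<close>.
\<close>

definition alternating :: "('a list \<Rightarrow> real) \<Rightarrow> bool" where
  "alternating f \<longleftrightarrow> (\<forall>us a b vs. distinct (us @ a # b # vs) \<longrightarrow>
     f (us @ b # a # vs) = - f (us @ a # b # vs))"

lemma alternatingD:
  "alternating f \<Longrightarrow> distinct (us @ a # b # vs) \<Longrightarrow> f (us @ b # a # vs) = - f (us @ a # b # vs)"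
  unfolding alternating_def by blast

lemma alt_sum_uminus: "alt_sum (\<lambda>ys. - f ys) xs = - alt_sum f xs"
  by (induction xs arbitrary: f) simp_all

lemma alt_sum_cong:
  assumes "distinct xs" "\<And>ys. set ys \<subseteq> set xs \<Longrightarrow> distinct ys \<Longrightarrow> f ys = g ys"
  shows "alt_sum f xs = alt_sum g xs"
  using assms
proof (induction xs arbitrary: f g)
  case (Cons x xs)
  have "f xs = g xs" using Cons.prems by auto
  moreover have "alt_sum (\<lambda>ys. f (x # ys)) xs = alt_sum (\<lambda>ys. g (x # ys)) xs"
    using Cons.prems by (intro Cons.IH Cons.prems(2)) auto
  ultimately show ?case by simp
qed simp

text \<open>In the terms that delete \<open>a\<close> or \<open>b\<close>, the two faces trade
  places and hence signs; every other face still contains the adjacent pair, so \<open>f\<close>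
  changes sign there. The sign rule is assumed only for entries from \<open>us\<close> and
  \<open>vs\<close> because the induction replaces \<open>f\<close> by
  \<open>\<lambda>ys. f (u # ys)\<close>, which inherits it only on lists avoiding
  \<open>u\<close>.\<close>

lemma alt_sum_swap:
  assumes "distinct (us @ a # b # vs)"
    and "\<And>us' vs'. set us' \<subseteq> set us \<Longrightarrow> set vs' \<subseteq> set vs \<Longrightarrow> distinct (us' @ a # b # vs') \<Longrightarrow>
      f (us' @ b # a # vs') = - f (us' @ a # b # vs')"
  shows "alt_sum f (us @ b # a # vs) = - alt_sum f (us @ a # b # vs)"
  using assms
proof (induction us arbitrary: f)
  case Nil
  have "alt_sum (\<lambda>zs. f (b # a # zs)) vs = alt_sum (\<lambda>zs. - f (a # b # zs)) vs"
    using Nil.prems(1) by (intro alt_sum_cong Nil.prems(2)[of "[]", simplified]) auto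
  then show ?case by (simp add: alt_sum_uminus)
next
  case (Cons u us)
  have "f (us @ b # a # vs) = - f (us @ a # b # vs)"
    using Cons.prems(1) by (intro Cons.prems(2)) auto
  moreover have "alt_sum (\<lambda>ys. f (u # ys)) (us @ b # a # vs)
      = - alt_sum (\<lambda>ys. f (u # ys)) (us @ a # b # vs)"
  proof (rule Cons.IH)
    fix us' vs' assume "set us' \<subseteq> set us" "set vs' \<subseteq> set vs" "distinct (us' @ a # b # vs')"
    then show "f (u # us' @ b # a # vs') = - f (u # us' @ a # b # vs')"
      using Cons.prems(2)[of "u # us'" vs'] Cons.prems(1) by auto
  qed (use Cons.prems(1) in simp)
  ultimately show ?case by simp
qed

lemma alternating_alt_sum: "alternating f \<Longrightarrow> alternating (alt_sum f)"
  unfolding alternating_def[of "alt_sum f"] by (iprover intro: alt_sum_swap alternatingD)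

text \<open>Bubble sort: adjacent swaps carry the first entry of the target to the front, and the
  tail is then rearranged behind it with \<open>P\<close> shifted by that entry.\<close>

lemma adjacent_swaps_reach:
  assumes "mset xs = mset ys" "P xs"
    and "\<And>us a b vs. P (us @ a # b # vs) \<Longrightarrow> P (us @ b # a # vs)"
  shows "P ys"
  using assms
proof (induction ys arbitrary: xs P)
  case (Cons y ys)
  have "y \<in> set xs" using Cons.prems(1) by (metis list.set_intros(1) set_mset_mset)
  then obtain us vs where xs: "xs = us @ y # vs" by (meson split_list)
  have front: "P (us @ y # vs) \<Longrightarrow> P (y # us @ vs)" for us vs
  proof (induction us arbitrary: vs rule: rev_induct)
    case (snoc u us)
    have "P (us @ y # u # vs)" using Cons.prems(3)[of us u y vs] snoc.prems by simp
    then show ?case using snoc.IH[of "u # vs"] by simp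
  qed simp
  show ?case
  proof (rule Cons.IH[where P = "\<lambda>zs. P (y # zs)"])
    show "mset (us @ vs) = mset ys" using Cons.prems(1) xs by simp
    show "P (y # us @ vs)" using front Cons.prems(2) xs by blast
    show "P (y # us @ b # a # vs)" if "P (y # us @ a # b # vs)" for us a b vs
      using Cons.prems(3)[of "y # us"] that by simp
  qed
qed simp

text \<open>Adjacent swaps reach every reordering, and each one flips the signs of \<open>f\<close>
  and \<open>g\<close> together. The cross-multiplied form avoids dividing by values that might
  vanish.\<close>

lemma alternating_proportional:
  assumes "alternating f" "alternating g" "distinct xs" "distinct ys" "set xs = set ys"
  shows "f ys * g xs = f xs * g ys"
proof -
  have "mset xs = mset ys" using assms(3-5) set_eq_iff_mset_eq_distinct by blast
  \<comment> \<open>Distinctness is part of the invariant because the sign rule is available only on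
    distinct lists.\<close>
  then have "distinct ys \<and> f ys * g xs = f xs * g ys"
  proof (rule adjacent_swaps_reach)
    fix us a b vs
    assume *: "distinct (us @ a # b # vs) \<and> f (us @ a # b # vs) * g xs = f xs * g (us @ a # b # vs)"
    then have d: "distinct (us @ a # b # vs)" ..
    show "distinct (us @ b # a # vs) \<and> f (us @ b # a # vs) * g xs = f xs * g (us @ b # a # vs)"
      unfolding alternatingD[OF assms(1) d] alternatingD[OF assms(2) d] using * by auto
  qed (use assms(3) in simp)
  then show ?thesis ..
qed

section \<open>Orientations and the parity of permutations\<close>

lemma same_orientation_refl: "same_orientation xs xs"
  unfolding same_orientation_def
  by (rule exI[of _ id]) (simp add: permutes_id evenperm_id)

text \<open>Makes the permutation in \<open>same_orientation\<close> unique for distinct vertices,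
  so that its existential statement is the parity of one given permutation.\<close>

lemma permute_list_inj:
  assumes "distinct xs" "p permutes {..<length xs}" "q permutes {..<length xs}"
    and "permute_list p xs = permute_list q xs"
  shows "p = q"
proof
  fix i show "p i = q i"
  proof (cases "i < length xs")
    case True
    then have "xs ! p i = xs ! q i"
      using assms(2-4) by (metis permute_list_nth)
    moreover have "p i < length xs" "q i < length xs"
      using True assms(2,3) permutes_in_image by fastforce+
    ultimately show ?thesis using assms(1) nth_eq_iff_index_eq by blast
  next
    case False
    then show ?thesis using assms(2,3) by (simp add: permutes_def)
  qed
qed

lemma same_orientation_swap:
  assumes "distinct xs" "distinct (us @ a # b # vs)" "set xs = set (us @ a # b # vs)"
  shows "same_orientation xs (us @ b # a # vs) \<longleftrightarrow> \<not> same_orientation xs (us @ a # b # vs)"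
proof -
  let ?ys = "us @ a # b # vs" and ?n = "length us"
  \<comment> \<open>Swapping the entries at positions \<open>?n\<close> and \<open>Suc ?n\<close>
    composes \<open>p\<close> with this transposition on the right, which flips its parity.\<close>
  let ?t = "Transposition.transpose ?n (Suc ?n)"
  have "mset xs = mset ?ys" using assms set_eq_iff_mset_eq_distinct by blast
  then obtain p where p: "p permutes {..<length xs}" "permute_list p xs = ?ys"
    using mset_eq_permutation by metis
  have len: "length xs = length ?ys" using p(2) by (metis length_permute_list)
  have t: "?t permutes {..<length xs}" using len by (intro permutes_swap_id) auto
  have pt: "p \<circ> ?t permutes {..<length xs}" by (rule permutes_compose[OF t p(1)])
  have swap: "permute_list (p \<circ> ?t) xs = us @ b # a # vs"
  proof -
    have "permute_list (p \<circ> ?t) xs = permute_list ?t ?ys"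
      using permute_list_compose[OF t] p(2) by metis
    also have "\<dots> = us @ b # a # vs"
      using t len
      by (intro nth_equalityI) (auto simp: permute_list_nth Transposition.transpose_def nth_append nth_Cons')
    finally show ?thesis .
  qed
  have ev: "evenperm (p \<circ> ?t) \<longleftrightarrow> \<not> evenperm p"
    using permutation_permutes p(1)
    by (subst evenperm_comp) (auto simp: evenperm_swap permutation_swap_id intro: permutes_imp_permutation)
  have "same_orientation xs ?ys \<longleftrightarrow> evenperm p"
    unfolding same_orientation_def using p permute_list_inj[OF assms(1)] by metis
  moreover have "same_orientation xs (us @ b # a # vs) \<longleftrightarrow> evenperm (p \<circ> ?t)"
    unfolding same_orientation_def using pt swap permute_list_inj[OF assms(1)] by metis
  ultimately show ?thesis using ev by simp
qed

lemma alternating_simplex_coord: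
  assumes "distinct (orient X \<sigma>)" "set (orient X \<sigma>) = \<sigma>"
  shows "alternating (\<lambda>ys. simplex_coord X ys \<sigma>)"
  unfolding alternating_def
proof (intro allI impI)
  fix us a b and vs :: "'a list" assume "distinct (us @ a # b # vs)"
  then show "simplex_coord X (us @ b # a # vs) \<sigma> = - simplex_coord X (us @ a # b # vs) \<sigma>"
    using same_orientation_swap[OF assms(1), of us a b vs] assms(2)
    by (auto simp: simplex_coord_def)
qed

lemma boundary_coeff_eq_alt_sum:
  "boundary_coeff X \<sigma> \<tau> = alt_sum (\<lambda>ys. simplex_coord X ys \<sigma>) (orient X \<tau>)"
  by (simp add: boundary_coeff_def alt_sum_eq_sum)

text \<open>The boundary does not depend on the ordering that represents an oriented simplex.\<close>

lemma boundary_coeff_mult_coord: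
  assumes "distinct (orient X \<rho>)" "set (orient X \<rho>) = \<rho>"
    and "distinct (orient X \<sigma>)" "set (orient X \<sigma>) = \<sigma>"
    and "distinct ys" "set ys = \<sigma>"
  shows "boundary_coeff X \<rho> \<sigma> * simplex_coord X ys \<sigma> = alt_sum (\<lambda>zs. simplex_coord X zs \<rho>) ys"
proof -
  have "simplex_coord X (orient X \<sigma>) \<sigma> = 1"
    using assms(4) by (simp add: simplex_coord_def same_orientation_refl)
  then show ?thesis
    using alternating_proportional[OF alternating_alt_sum[OF alternating_simplex_coord[OF assms(1,2)]]
        alternating_simplex_coord[OF assms(3,4)] assms(3,5)] assms(4,6)
    by (simp add: boundary_coeff_eq_alt_sum)
qed

text \<open>The entrywise form of the vanishing boundary of a boundary. Expanding the boundary of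
  \<open>\<tau>\<close> and summing over \<sigma> turns each term into the boundary of a face of
  \<open>\<tau>\<close>, so the total is a twofold alternating sum.\<close>

lemma boundary_coeff_comp:
  assumes X: "oriented_weighted_complex X"
    and \<rho>: "\<rho> \<in> simplices X (k - 1)" and \<tau>: "\<tau> \<in> simplices X (k + 1)"
  shows "(\<Sum>\<sigma>\<in>simplices X k. boundary_coeff X \<rho> \<sigma> * boundary_coeff X \<sigma> \<tau>) = 0"
proof -
  let ?xs = "orient X \<tau>" and ?S = "simplices X k"
  have or: "distinct (orient X \<sigma>)" "set (orient X \<sigma>) = \<sigma>" if "\<sigma> \<in> complex X" for \<sigma>
    using X that unfolding oriented_weighted_complex_def by auto
  have cpl: "\<rho> \<in> complex X" "\<tau> \<in> complex X" using \<rho> \<tau> by (auto simp: simplices_def)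
  have closed: "\<sigma>' \<in> complex X" if "\<sigma> \<in> complex X" "\<sigma>' \<subseteq> \<sigma>" "\<sigma>' \<noteq> {}" for \<sigma> \<sigma>'
  proof -
    have "\<forall>\<sigma>\<in>complex X. finite \<sigma> \<and> \<sigma> \<noteq> {} \<and> (\<forall>\<tau>\<subseteq>\<sigma>. \<tau> \<noteq> {} \<longrightarrow> \<tau> \<in> complex X)"
      using X unfolding oriented_weighted_complex_def simplicial_complex_def by (elim conjE)
    from bspec[OF this that(1)] have "\<forall>\<tau>\<subseteq>\<sigma>. \<tau> \<noteq> {} \<longrightarrow> \<tau> \<in> complex X" by (elim conjE)
    from mp[OF mp[OF spec[OF this] that(2)] that(3)] show ?thesis .
  qed
  have fin: "finite ?S"
    using X by (auto simp: oriented_weighted_complex_def simplicial_complex_def simplices_def)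
  have face: "(\<Sum>\<sigma>\<in>?S. boundary_coeff X \<rho> \<sigma> * simplex_coord X (delete_nth j ?xs) \<sigma>)
      = alt_sum (\<lambda>zs. simplex_coord X zs \<rho>) (delete_nth j ?xs)" if j: "j < length ?xs" for j
  proof -
    let ?ys = "delete_nth j ?xs"
    have set: "set ?ys = \<tau> - {?xs ! j}" using set_delete_nth or[OF cpl(2)] j by metis
    have "finite \<tau>" using or(2)[OF cpl(2)] by (metis List.finite_set)
    moreover have "?xs ! j \<in> \<tau>" using or(2)[OF cpl(2)] j nth_mem by metis
    ultimately have "Suc (card (set ?ys)) = card \<tau>"
      by (metis set card_Suc_Diff1)
    then have card: "int (card (set ?ys)) = k + 1"
      using \<tau> by (simp add: simplices_def simplex_order_def)
    \<comment> \<open>The nonempty \<open>\<rho>\<close> rules out that \<open>\<tau>\<close> is a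
      single vertex, whose only face would be the empty set and thus no simplex.\<close>
    have "0 < card \<rho>"
      using X cpl(1) unfolding oriented_weighted_complex_def simplicial_complex_def
      by (simp add: card_gt_0_iff)
    then have "0 \<le> k" using \<rho> by (simp add: simplices_def simplex_order_def)
    with card have "set ?ys \<noteq> {}" by auto
    then have "set ?ys \<in> complex X"
      using closed[OF cpl(2), of "set ?ys"] set by blast
    then have mem: "set ?ys \<in> ?S" using card by (simp add: simplices_def simplex_order_def)
    have dist: "distinct ?ys"
      using or(1)[OF cpl(2)] unfolding delete_nth_def
      by (simp add: set_take_disj_set_drop_if_distinct)
    \<comment> \<open>The coordinate vanishes unless \<sigma> is the vertex set of the face, so one
      summand survives.\<close>
    have "(\<Sum>\<sigma>\<in>?S. boundary_coeff X \<rho> \<sigma> * simplex_coord X ?ys \<sigma>)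
        = (\<Sum>\<sigma>\<in>?S. if \<sigma> = set ?ys then boundary_coeff X \<rho> \<sigma> * simplex_coord X ?ys \<sigma> else 0)"
      by (intro sum.cong) (auto simp: simplex_coord_def)
    also have "\<dots> = boundary_coeff X \<rho> (set ?ys) * simplex_coord X ?ys (set ?ys)"
      using fin mem by simp
    also have "\<dots> = alt_sum (\<lambda>zs. simplex_coord X zs \<rho>) ?ys"
      using boundary_coeff_mult_coord or[OF cpl(1)] or[OF \<open>set ?ys \<in> complex X\<close>] dist by blast
    finally show ?thesis .
  qed
  have "(\<Sum>\<sigma>\<in>?S. boundary_coeff X \<rho> \<sigma> * boundary_coeff X \<sigma> \<tau>)
      = (\<Sum>j<length ?xs. (- 1) ^ j *
          (\<Sum>\<sigma>\<in>?S. boundary_coeff X \<rho> \<sigma> * simplex_coord X (delete_nth j ?xs) \<sigma>))"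
    unfolding boundary_coeff_def[of X _ \<tau>] sum_distrib_left
    by (subst sum.swap) (simp add: mult_ac)
  also have "\<dots> = alt_sum (alt_sum (\<lambda>zs. simplex_coord X zs \<rho>)) ?xs"
    by (simp add: face alt_sum_eq_sum[of "alt_sum _"])
  finally show ?thesis by (simp add: alt_sum_alt_sum)
qed

section \<open>Incidence and weight matrices\<close>

lemma incidence_mat_carrier[simp]:
  "incidence_mat X k \<in> carrier_mat (num_simplices X (k - 1)) (num_simplices X k)"
  by (simp add: incidence_mat_def)

lemma incidence_mat_comp:
  assumes X: "oriented_weighted_complex X"
  shows "incidence_mat X k * incidence_mat X (k + 1)
    = 0\<^sub>m (num_simplices X (k - 1)) (num_simplices X (k + 1))"
proof (rule eq_matI)
  fix i j assume ij: "i < dim_row (0\<^sub>m (num_simplices X (k - 1)) (num_simplices X (k + 1)) :: real mat)"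
    "j < dim_col (0\<^sub>m (num_simplices X (k - 1)) (num_simplices X (k + 1)) :: real mat)"
  have bij: "bij_betw (nth_simplex X l) {..<num_simplices X l} (simplices X l)" for l
    using X by (simp add: oriented_weighted_complex_def)
  let ?c = "\<lambda>\<sigma>. boundary_coeff X (nth_simplex X (k - 1) i) \<sigma> * boundary_coeff X \<sigma> (nth_simplex X (k + 1) j)"
  have "(incidence_mat X k * incidence_mat X (k + 1)) $$ (i, j)
      = (\<Sum>l<num_simplices X k. ?c (nth_simplex X k l))"
    using ij by (simp add: incidence_mat_def scalar_prod_def lessThan_atLeast0)
  also have "\<dots> = (\<Sum>\<sigma>\<in>simplices X k. ?c \<sigma>)"
    by (rule sum.reindex_bij_betw[OF bij])
  also have "\<dots> = 0"
    using ij bij[of "k - 1"] bij[of "k + 1"] by (intro boundary_coeff_comp assms) (auto dest: bij_betwE)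
  finally show "(incidence_mat X k * incidence_mat X (k + 1)) $$ (i, j)
      = 0\<^sub>m (num_simplices X (k - 1)) (num_simplices X (k + 1)) $$ (i, j)" using ij by simp
qed (simp_all add: incidence_mat_def)

text \<open>The row dimension with \<open>k + 1 - 1\<close> already normalised to
  \<open>k\<close>.\<close>

lemma incidence_mat_succ_carrier[simp]:
  "incidence_mat X (k + 1) \<in> carrier_mat (num_simplices X k) (num_simplices X (k + 1))"
  using incidence_mat_carrier[of X "k + 1"] by simp

lemma weight_mat_carrier[simp]:
  "weight_mat X k \<in> carrier_mat (num_simplices X k) (num_simplices X k)"
  "weight_mat_inv X k \<in> carrier_mat (num_simplices X k) (num_simplices X k)"
  by (simp_all add: weight_mat_def weight_mat_inv_def)

subsection \<open>Weighted least squares\<close>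

lemma transpose_mat_diag: "(mat_diag n f)\<^sup>T = mat_diag n f"
  by (auto simp: mat_diag_def)

lemma scalar_prod_mat_diag:
  fixes v :: "real vec"
  assumes "v \<in> carrier_vec n"
  shows "v \<bullet> (mat_diag n w *\<^sub>v v) = (\<Sum>i<n. w i * (v $ i)\<^sup>2)"
proof -
  have "(mat_diag n w *\<^sub>v v) $ i = w i * v $ i" if "i < n" for i
  proof -
    have "(mat_diag n w *\<^sub>v v) $ i = (\<Sum>j<n. (if i = j then w j else 0) * v $ j)"
      using assms that by (auto simp: mat_diag_def scalar_prod_def lessThan_atLeast0)
    also have "\<dots> = (\<Sum>j<n. if i = j then w j * v $ j else 0)"
      by (intro sum.cong) auto
    finally have "(mat_diag n w *\<^sub>v v) $ i = (\<Sum>j<n. if i = j then w j * v $ j else 0)" .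
    then show ?thesis using that by simp
  qed
  then show ?thesis
    using assms
    by (auto simp: scalar_prod_def mat_diag_def lessThan_atLeast0 power2_eq_square intro!: sum.cong)
qed

lemma scalar_prod_mat_diag_nonneg:
  fixes v :: "real vec"
  assumes "v \<in> carrier_vec n" "\<And>i. i < n \<Longrightarrow> 0 < w i"
  shows "0 \<le> v \<bullet> (mat_diag n w *\<^sub>v v)"
  using assms by (auto simp: scalar_prod_mat_diag less_imp_le intro!: sum_nonneg)

lemma scalar_prod_mat_diag_eq_0:
  fixes v :: "real vec"
  assumes "v \<in> carrier_vec n" "\<And>i. i < n \<Longrightarrow> 0 < w i"
  shows "v \<bullet> (mat_diag n w *\<^sub>v v) = 0 \<longleftrightarrow> v = 0\<^sub>v n"
proof
  assume "v \<bullet> (mat_diag n w *\<^sub>v v) = 0"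
  then have "(\<Sum>i<n. w i * (v $ i)\<^sup>2) = 0" using assms(1) by (simp add: scalar_prod_mat_diag)
  then have "\<forall>i\<in>{..<n}. w i * (v $ i)\<^sup>2 = 0"
    using assms(2) by (subst (asm) sum_nonneg_eq_0_iff) (auto simp: less_imp_le)
  then show "v = 0\<^sub>v n" using assms by (intro eq_vecI) force+
qed (use assms in \<open>simp add: scalar_prod_mat_diag\<close>)

lemma symmetric_form_add:
  fixes W :: "real mat"
  assumes W: "W \<in> carrier_mat n n" "W\<^sup>T = W"
    and u: "u \<in> carrier_vec n" and v: "v \<in> carrier_vec n"
  shows "(u + v) \<bullet> (W *\<^sub>v (u + v)) = u \<bullet> (W *\<^sub>v u) + 2 * (v \<bullet> (W *\<^sub>v u)) + v \<bullet> (W *\<^sub>v v)"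
proof -
  have "u \<bullet> (W *\<^sub>v v) = v \<bullet> (W *\<^sub>v u)"
    using transpose_vec_mult_scalar[OF W(1) v u] W u v
    by (metis comm_scalar_prod mult_mat_vec_carrier)
  then show ?thesis
    using W u v
    by (simp add: mult_add_distrib_mat_vec[OF W(1)] add_scalar_prod_distrib[of _ n]
        scalar_prod_add_distrib[of _ n])
qed

text \<open>Up to the factor 2, \<open>?g\<close> is the gradient of the quadratic \<open>?q\<close>
  at \<open>x\<close>. The expansion around \<open>x\<close> has linear term
  \<open>2 * (d \<bullet> ?g)\<close> and a nonnegative quadratic term, so a vanishing gradient
  gives a minimum; conversely, a step against the gradient would lower the value.\<close>

lemma weighted_least_squares_normal_equation:
  fixes A W :: "real mat"
  assumes A: "A \<in> carrier_mat n m" and W: "W \<in> carrier_mat n n" "W\<^sup>T = W"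
    and nonneg: "\<And>v. v \<in> carrier_vec n \<Longrightarrow> 0 \<le> v \<bullet> (W *\<^sub>v v)"
    and s: "s \<in> carrier_vec n" and x: "x \<in> carrier_vec m"
  shows "is_arg_min (\<lambda>y. (A *\<^sub>v y - s) \<bullet> (W *\<^sub>v (A *\<^sub>v y - s))) (\<lambda>y. y \<in> carrier_vec m) x
    \<longleftrightarrow> A\<^sup>T *\<^sub>v (W *\<^sub>v (A *\<^sub>v x - s)) = 0\<^sub>v m" (is "is_arg_min ?q _ _ \<longleftrightarrow> ?g = _")
proof -
  let ?r = "A *\<^sub>v x - s"
  have r: "?r \<in> carrier_vec n" and g: "?g \<in> carrier_vec m"
    using A W s x by auto
  have expand: "?q (x + d) = ?q x + 2 * (d \<bullet> ?g) + (A *\<^sub>v d) \<bullet> (W *\<^sub>v (A *\<^sub>v d))"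
    if d: "d \<in> carrier_vec m" for d
  proof -
    have Ad: "A *\<^sub>v d \<in> carrier_vec n" using A d by auto
    have "A *\<^sub>v (x + d) - s = ?r + A *\<^sub>v d"
      using A x d s by (auto simp: mult_add_distrib_mat_vec[OF A])
    moreover have "(A *\<^sub>v d) \<bullet> (W *\<^sub>v ?r) = d \<bullet> ?g"
      using transpose_vec_mult_scalar[OF A d, of "W *\<^sub>v ?r"] W(1) r Ad g d
      by (metis comm_scalar_prod mult_mat_vec_carrier)
    ultimately show ?thesis
      using symmetric_form_add[OF W r Ad] by simp
  qed
  show ?thesis
  proof
    assume min: "is_arg_min ?q (\<lambda>y. y \<in> carrier_vec m) x"
    define G where "G = ?g \<bullet> ?g"
    define Q where "Q = (A *\<^sub>v ?g) \<bullet> (W *\<^sub>v (A *\<^sub>v ?g))"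
    \<comment> \<open>The exact line search would use \<open>G / Q\<close>; adding 1 keeps the
      denominator positive when \<open>Q\<close> is 0 and still forces \<open>t\<close> to be
      0.\<close>
    define t where "t = G / (Q + 1)"
    have Q: "0 \<le> Q" unfolding Q_def using A g by (intro nonneg) auto
    have Ag: "A *\<^sub>v ?g \<in> carrier_vec n" using A g by auto
    have "x + (- t) \<cdot>\<^sub>v ?g \<in> carrier_vec m" using x g by auto
    then have "?q x \<le> ?q (x + (- t) \<cdot>\<^sub>v ?g)"
      using min unfolding is_arg_min_def by (meson not_le)
    also have "\<dots> = ?q x - 2 * t * G + t\<^sup>2 * Q"
      using g A W Ag
      by (subst expand) (simp_all add: G_def Q_def mult_mat_vec[OF A] mult_mat_vec[OF W(1)] power2_eq_square)
    finally have "2 * t * G \<le> t\<^sup>2 * Q" by simp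
    moreover have "G = t * (Q + 1)" using Q by (simp add: t_def)
    ultimately have "t\<^sup>2 * (Q + 2) \<le> 0" by (simp add: power2_eq_square algebra_simps)
    then have "t = 0" using Q by (simp add: mult_le_0_iff)
    then have "G = 0" using \<open>G = t * (Q + 1)\<close> by simp
    \<comment> \<open>Over the reals, the conjugated scalar product is the ordinary one.\<close>
    then show "?g = 0\<^sub>v m"
      using conjugate_square_eq_0_vec[OF g] by (simp add: G_def)
  next
    assume 0: "?g = 0\<^sub>v m"
    have "?q x \<le> ?q y" if y: "y \<in> carrier_vec m" for y
    proof -
      have "y = x + (y - x)" using x y by auto
      moreover have d: "y - x \<in> carrier_vec m" using x y by auto
      moreover have "0 \<le> (A *\<^sub>v (y - x)) \<bullet> (W *\<^sub>v (A *\<^sub>v (y - x)))"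
        using A d by (intro nonneg) auto
      ultimately show ?thesis using expand[OF d] 0 by simp
    qed
    then show "is_arg_min ?q (\<lambda>y. y \<in> carrier_vec m) x"
      unfolding is_arg_min_def using x by (meson not_le)
  qed
qed

subsection \<open>Laplacians\<close>

lemma weight_pos:
  assumes "oriented_weighted_complex X" "i < num_simplices X k"
  shows "0 < weight X (nth_simplex X k i)"
  using assms unfolding oriented_weighted_complex_def simplices_def bij_betw_def by blast

lemma incidence_mat_dim[simp]:
  "dim_row (incidence_mat X k) = num_simplices X (k - 1)"
  "dim_col (incidence_mat X k) = num_simplices X k"
  by (simp_all add: incidence_mat_def)

lemma weight_mat_dim[simp]:
  "dim_row (weight_mat X k) = num_simplices X k"
  "dim_col (weight_mat X k) = num_simplices X k"
  "dim_row (weight_mat_inv X k) = num_simplices X k"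
  "dim_col (weight_mat_inv X k) = num_simplices X k"
  by (simp_all add: weight_mat_def weight_mat_inv_def mat_diag_def)

text \<open>The premises are equations between dimensions, without further dimension variables, so
  the rule can be used for rewriting.\<close>

lemma mult_mat_mat_vec:
  "dim_col A = dim_row B \<Longrightarrow> dim_col B = dim_vec v \<Longrightarrow> (A * B) *\<^sub>v v = A *\<^sub>v (B *\<^sub>v v)"
  by (metis assoc_mult_mat_vec carrier_matI carrier_vecI)

lemma mult_mat_vec_carrier_dim[simp]: "dim_row A = n \<Longrightarrow> A *\<^sub>v v \<in> carrier_vec n"
  by (simp add: carrier_vecI)

lemma mult_mat_zero_vec[simp]:
  "dim_row A = n \<Longrightarrow> dim_col A = m \<Longrightarrow> A *\<^sub>v 0\<^sub>v m = 0\<^sub>v n"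
  by (intro eq_vecI) auto

lemma mult_zero_mat_vec: "v \<in> carrier_vec m \<Longrightarrow> 0\<^sub>m n m *\<^sub>v v = 0\<^sub>v n"
  by (intro eq_vecI) auto

lemma minus_vec_eq_0_iff:
  fixes u v :: "'a :: group_add vec"
  assumes "u \<in> carrier_vec n" "v \<in> carrier_vec n"
  shows "u - v = 0\<^sub>v n \<longleftrightarrow> u = v"
proof
  assume "u - v = 0\<^sub>v n"
  then have "(u - v) $ i = 0" if "i < n" for i using that by simp
  then show "u = v" using assms by (intro eq_vecI) auto
qed (use assms in auto)

lemma weight_mat_vec_inverse:
  assumes "oriented_weighted_complex X" "v \<in> carrier_vec (num_simplices X k)"
  shows "weight_mat X k *\<^sub>v (weight_mat_inv X k *\<^sub>v v) = v"
    and "weight_mat_inv X k *\<^sub>v (weight_mat X k *\<^sub>v v) = v"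
  using assms weight_mat_inverse[OF assms(1), of k]
  by (simp_all flip: mult_mat_mat_vec)

lemma transpose_weight_mat: "(weight_mat X k)\<^sup>T = weight_mat X k"
  and transpose_weight_mat_inv: "(weight_mat_inv X k)\<^sup>T = weight_mat_inv X k"
  by (simp_all add: weight_mat_def weight_mat_inv_def transpose_mat_diag)

lemma weighted_sqnorm_nonneg:
  assumes "oriented_weighted_complex X" "v \<in> carrier_vec (num_simplices X k)"
  shows "0 \<le> weighted_sqnorm X k v"
  unfolding weighted_sqnorm_def weight_mat_def
  using assms by (intro scalar_prod_mat_diag_nonneg weight_pos)

lemma weighted_sqnorm_eq_0:
  assumes "oriented_weighted_complex X" "v \<in> carrier_vec (num_simplices X k)"
  shows "weighted_sqnorm X k v = 0 \<longleftrightarrow> v = 0\<^sub>v (num_simplices X k)"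
  unfolding weighted_sqnorm_def weight_mat_def
  using assms by (intro scalar_prod_mat_diag_eq_0 weight_pos)

lemma up_laplacian_mult_vec:
  assumes "v \<in> carrier_vec (num_simplices X k)"
  shows "up_laplacian X k *\<^sub>v v = weight_mat_inv X k *\<^sub>v (incidence_mat X (k + 1) *\<^sub>v
    (weight_mat X (k + 1) *\<^sub>v ((incidence_mat X (k + 1))\<^sup>T *\<^sub>v v)))"
  using assms by (simp add: up_laplacian_def mult_mat_mat_vec)

lemma down_laplacian_mult_vec:
  assumes "v \<in> carrier_vec (num_simplices X k)"
  shows "down_laplacian X k *\<^sub>v v = (incidence_mat X k)\<^sup>T *\<^sub>v (weight_mat_inv X (k - 1) *\<^sub>v
    (incidence_mat X k *\<^sub>v (weight_mat X k *\<^sub>v v)))"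
  using assms by (simp add: down_laplacian_def mult_mat_mat_vec)

lemma boundary_mat_mult_vec:
  assumes "v \<in> carrier_vec (num_simplices X k)"
  shows "boundary_mat X k *\<^sub>v v = weight_mat_inv X (k - 1) *\<^sub>v (incidence_mat X k *\<^sub>v (weight_mat X k *\<^sub>v v))"
  using assms by (simp add: boundary_mat_def mult_mat_mat_vec)

lemma up_laplacian_carrier[simp]:
  "up_laplacian X k \<in> carrier_mat (num_simplices X k) (num_simplices X k)"
  by (rule carrier_matI) (simp_all add: up_laplacian_def)

lemma down_laplacian_carrier[simp]:
  "down_laplacian X k \<in> carrier_mat (num_simplices X k) (num_simplices X k)"
  by (rule carrier_matI) (simp_all add: down_laplacian_def)

lemma boundary_mat_dim[simp]:
  "dim_row (boundary_mat X k) = num_simplices X (k - 1)"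
  "dim_col (boundary_mat X k) = num_simplices X k"
  by (simp_all add: boundary_mat_def)

lemma transpose_mat_scalar_prod:
  fixes v :: "'a :: comm_semiring_0 vec"
  shows "dim_vec u = dim_col A \<Longrightarrow> dim_vec v = dim_row A \<Longrightarrow> u \<bullet> (A\<^sup>T *\<^sub>v v) = (A *\<^sub>v u) \<bullet> v"
  using transpose_vec_mult_scalar[of A "dim_row A" "dim_col A" u v]
  by (metis carrier_matI carrier_vecI comm_scalar_prod dim_mult_mat_vec index_transpose_mat(2))

text \<open>
  In the inner product given by \<open>W\<^sub>k\<close> both Laplacians are positive semidefinite, so that the kernel
  of their sum is the intersection of their kernels.
\<close>

lemma hodge_kernel_iff:
  assumes X: "oriented_weighted_complex X" and r: "r \<in> carrier_vec (num_simplices X k)"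
  shows "hodge_laplacian X k *\<^sub>v r = 0\<^sub>v (num_simplices X k) \<longleftrightarrow>
    incidence_mat X k *\<^sub>v (weight_mat X k *\<^sub>v r) = 0\<^sub>v (num_simplices X (k - 1)) \<and>
    (incidence_mat X (k + 1))\<^sup>T *\<^sub>v r = 0\<^sub>v (num_simplices X (k + 1))" (is "_ \<longleftrightarrow> ?b = _ \<and> ?c = _")
proof -
  let ?B = "incidence_mat X k" and ?C = "incidence_mat X (k + 1)" and ?W = "weight_mat X k"
  let ?V' = "weight_mat_inv X (k - 1)"
  have dim_r: "dim_vec r = num_simplices X k" using r by simp
  have b: "?b \<in> carrier_vec (num_simplices X (k - 1))" "?V' *\<^sub>v ?b \<in> carrier_vec (num_simplices X (k - 1))"
    and c: "?c \<in> carrier_vec (num_simplices X (k + 1))"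
    by simp_all
  have sum: "hodge_laplacian X k *\<^sub>v r = up_laplacian X k *\<^sub>v r + down_laplacian X k *\<^sub>v r"
    unfolding hodge_laplacian_def
    by (rule add_mult_distrib_mat_vec[OF up_laplacian_carrier down_laplacian_carrier r])
  show ?thesis
  proof
    assume 0: "hodge_laplacian X k *\<^sub>v r = 0\<^sub>v (num_simplices X k)"
    have W_sym: "r \<bullet> (?W *\<^sub>v v) = (?W *\<^sub>v r) \<bullet> v" if "v \<in> carrier_vec (num_simplices X k)" for v
      using transpose_mat_scalar_prod[of r ?W v] that dim_r by (simp add: transpose_weight_mat)
    \<comment> \<open>\<open>?W\<close> cancels the leading inverse weights of the up Laplacian;
      moving \<open>?C\<close> across the scalar product leaves the square norm of the coboundary of
      \<open>r\<close>.\<close>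
    have up: "r \<bullet> (?W *\<^sub>v (up_laplacian X k *\<^sub>v r)) = weighted_sqnorm X (k + 1) ?c"
    proof -
      have "?W *\<^sub>v (up_laplacian X k *\<^sub>v r) = ?C *\<^sub>v (weight_mat X (k + 1) *\<^sub>v ?c)"
        by (simp add: up_laplacian_mult_vec[OF r] weight_mat_vec_inverse[OF X])
      then show ?thesis
        using transpose_mat_scalar_prod[of r "?C\<^sup>T" "weight_mat X (k + 1) *\<^sub>v ?c"] dim_r
        by (simp add: weighted_sqnorm_def)
    qed
    \<comment> \<open>Here \<open>?V' *\<^sub>v ?b\<close> is the boundary of \<open>r\<close>, and
      the weights of order \<open>k - 1\<close> turn it back into \<open>?b\<close>.\<close>
    have down: "r \<bullet> (?W *\<^sub>v (down_laplacian X k *\<^sub>v r)) = weighted_sqnorm X (k - 1) (?V' *\<^sub>v ?b)"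
    proof -
      have "r \<bullet> (?W *\<^sub>v (down_laplacian X k *\<^sub>v r)) = (?W *\<^sub>v r) \<bullet> (?B\<^sup>T *\<^sub>v (?V' *\<^sub>v ?b))"
        by (simp add: down_laplacian_mult_vec[OF r] W_sym)
      also have "\<dots> = ?b \<bullet> (?V' *\<^sub>v ?b)"
        by (rule transpose_mat_scalar_prod) simp_all
      also have "\<dots> = (?V' *\<^sub>v ?b) \<bullet> ?b" by (rule comm_scalar_prod[OF b])
      finally show ?thesis by (simp add: weighted_sqnorm_def weight_mat_vec_inverse[OF X b(1)])
    qed
    have "?W *\<^sub>v (up_laplacian X k *\<^sub>v r + down_laplacian X k *\<^sub>v r)
        = ?W *\<^sub>v (up_laplacian X k *\<^sub>v r) + ?W *\<^sub>v (down_laplacian X k *\<^sub>v r)"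
      using r mult_mat_vec_carrier[OF up_laplacian_carrier r] mult_mat_vec_carrier[OF down_laplacian_carrier r]
      by (intro mult_add_distrib_mat_vec[OF weight_mat_carrier(1)])
    then have "?W *\<^sub>v (up_laplacian X k *\<^sub>v r) + ?W *\<^sub>v (down_laplacian X k *\<^sub>v r) = ?W *\<^sub>v 0\<^sub>v (num_simplices X k)"
      using 0 sum by metis
    also have "\<dots> = 0\<^sub>v (num_simplices X k)" by simp
    finally have "r \<bullet> (?W *\<^sub>v (up_laplacian X k *\<^sub>v r) + ?W *\<^sub>v (down_laplacian X k *\<^sub>v r)) = 0"
      using r by simp
    then have "weighted_sqnorm X (k + 1) ?c + weighted_sqnorm X (k - 1) (?V' *\<^sub>v ?b) = 0"
      by (subst (asm) scalar_prod_add_distrib[OF r]) (simp_all add: up down)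
    \<comment> \<open>Two nonnegative square norms with sum 0 both vanish, and the norms are
      definite because the weights are positive.\<close>
    with weighted_sqnorm_nonneg[OF X c] weighted_sqnorm_nonneg[OF X b(2)]
    have "?c = 0\<^sub>v (num_simplices X (k + 1))" and V'b: "?V' *\<^sub>v ?b = 0\<^sub>v (num_simplices X (k - 1))"
      using weighted_sqnorm_eq_0[OF X c] weighted_sqnorm_eq_0[OF X b(2)] by linarith+
    moreover have "?b = 0\<^sub>v (num_simplices X (k - 1))"
      using weight_mat_vec_inverse(1)[OF X b(1)] unfolding V'b by simp
    ultimately show "?b = 0\<^sub>v (num_simplices X (k - 1)) \<and> ?c = 0\<^sub>v (num_simplices X (k + 1))" by simp
  next
    assume "?b = 0\<^sub>v (num_simplices X (k - 1)) \<and> ?c = 0\<^sub>v (num_simplices X (k + 1))"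
    then show "hodge_laplacian X k *\<^sub>v r = 0\<^sub>v (num_simplices X k)"
      unfolding sum up_laplacian_mult_vec[OF r] down_laplacian_mult_vec[OF r] by auto
  qed
qed

section \<open>Laplacian equations and least squares as orthogonality conditions\<close>

lemma up_laplacian_equation_iff:
  assumes X: "oriented_weighted_complex X"
    and s: "s \<in> carrier_vec (num_simplices X k)" and \<alpha>: "\<alpha> \<in> carrier_vec (num_simplices X (k - 1))"
  shows "up_laplacian X (k - 1) *\<^sub>v \<alpha>
      = (weight_mat_inv X (k - 1) * incidence_mat X k * weight_mat X k) *\<^sub>v s \<longleftrightarrow>
    incidence_mat X k *\<^sub>v (weight_mat X k *\<^sub>v ((incidence_mat X k)\<^sup>T *\<^sub>v \<alpha> - s))
      = 0\<^sub>v (num_simplices X (k - 1))"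
proof -
  let ?B = "incidence_mat X k" and ?W = "weight_mat X k"
  have c: "?B\<^sup>T *\<^sub>v \<alpha> \<in> carrier_vec (num_simplices X k)" "?W *\<^sub>v v \<in> carrier_vec (num_simplices X k)"
    "?B *\<^sub>v v \<in> carrier_vec (num_simplices X (k - 1))" for v
    by simp_all
  have "up_laplacian X (k - 1) *\<^sub>v \<alpha> = (weight_mat_inv X (k - 1) * ?B * ?W) *\<^sub>v s \<longleftrightarrow>
      weight_mat_inv X (k - 1) *\<^sub>v (?B *\<^sub>v (?W *\<^sub>v (?B\<^sup>T *\<^sub>v \<alpha>)))
        = weight_mat_inv X (k - 1) *\<^sub>v (?B *\<^sub>v (?W *\<^sub>v s))"
    using up_laplacian_mult_vec[OF \<alpha>] s by (simp add: mult_mat_mat_vec)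
  \<comment> \<open>The inverse weight matrix is injective, so it can be cancelled.\<close>
  also have "\<dots> \<longleftrightarrow> ?B *\<^sub>v (?W *\<^sub>v (?B\<^sup>T *\<^sub>v \<alpha>)) = ?B *\<^sub>v (?W *\<^sub>v s)"
    using weight_mat_vec_inverse(1)[OF X c(3)] by metis
  also have "\<dots> \<longleftrightarrow> ?B *\<^sub>v (?W *\<^sub>v (?B\<^sup>T *\<^sub>v \<alpha>)) - ?B *\<^sub>v (?W *\<^sub>v s) = 0\<^sub>v (num_simplices X (k - 1))"
    using minus_vec_eq_0_iff[OF c(3) c(3)] by simp
  also have "?B *\<^sub>v (?W *\<^sub>v (?B\<^sup>T *\<^sub>v \<alpha>)) - ?B *\<^sub>v (?W *\<^sub>v s) = ?B *\<^sub>v (?W *\<^sub>v (?B\<^sup>T *\<^sub>v \<alpha> - s))"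
    by (simp add: mult_minus_distrib_mat_vec[OF weight_mat_carrier(1) c(1) s]
        mult_minus_distrib_mat_vec[OF incidence_mat_carrier c(2) c(2)])
  finally show ?thesis .
qed

text \<open>The down Laplacian factors as the transposed incidence matrix after
  \<open>boundary_mat X (k + 1)\<close>.\<close>

lemma down_laplacian_equation_iff:
  assumes s: "s \<in> carrier_vec (num_simplices X k)" and \<beta>: "\<beta> \<in> carrier_vec (num_simplices X (k + 1))"
  shows "down_laplacian X (k + 1) *\<^sub>v \<beta> = (incidence_mat X (k + 1))\<^sup>T *\<^sub>v s \<longleftrightarrow>
    (incidence_mat X (k + 1))\<^sup>T *\<^sub>v (boundary_mat X (k + 1) *\<^sub>v \<beta> - s) = 0\<^sub>v (num_simplices X (k + 1))"
proof -
  let ?C = "incidence_mat X (k + 1)"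
  have E: "boundary_mat X (k + 1) *\<^sub>v \<beta> \<in> carrier_vec (num_simplices X k)"
    by simp
  have "down_laplacian X (k + 1) *\<^sub>v \<beta> = ?C\<^sup>T *\<^sub>v (boundary_mat X (k + 1) *\<^sub>v \<beta>)"
    using down_laplacian_mult_vec[OF \<beta>] boundary_mat_mult_vec[OF \<beta>] by simp
  moreover have "?C\<^sup>T *\<^sub>v (boundary_mat X (k + 1) *\<^sub>v \<beta> - s)
      = ?C\<^sup>T *\<^sub>v (boundary_mat X (k + 1) *\<^sub>v \<beta>) - ?C\<^sup>T *\<^sub>v s"
    using E s by (intro mult_minus_distrib_mat_vec[of _ "num_simplices X (k + 1)" "num_simplices X k"]) simp_all
  moreover have "?C\<^sup>T *\<^sub>v v \<in> carrier_vec (num_simplices X (k + 1))" for v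
    by simp
  ultimately show ?thesis by (simp add: minus_vec_eq_0_iff)
qed

lemma coboundary_least_squares_iff:
  assumes X: "oriented_weighted_complex X"
    and s: "s \<in> carrier_vec (num_simplices X k)" and \<alpha>: "\<alpha> \<in> carrier_vec (num_simplices X (k - 1))"
  shows "is_arg_min (\<lambda>\<alpha>. weighted_sqnorm X k (coboundary_mat X k *\<^sub>v \<alpha> - s))
      (\<lambda>\<alpha>. \<alpha> \<in> carrier_vec (num_simplices X (k - 1))) \<alpha> \<longleftrightarrow>
    incidence_mat X k *\<^sub>v (weight_mat X k *\<^sub>v ((incidence_mat X k)\<^sup>T *\<^sub>v \<alpha> - s))
      = 0\<^sub>v (num_simplices X (k - 1))"
  using weighted_least_squares_normal_equation[OF _ weight_mat_carrier(1) transpose_weight_mat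
      weighted_sqnorm_nonneg[OF X, unfolded weighted_sqnorm_def] s \<alpha>, of "(incidence_mat X k)\<^sup>T"]
  by (simp add: weighted_sqnorm_def coboundary_mat_def)

text \<open>In the weighted inner products, the boundary operator is adjoint to the coboundary
  operator.\<close>

lemma transpose_boundary_mat_weight:
  assumes X: "oriented_weighted_complex X" and v: "v \<in> carrier_vec (num_simplices X k)"
  shows "(boundary_mat X (k + 1))\<^sup>T *\<^sub>v (weight_mat X k *\<^sub>v v)
    = weight_mat X (k + 1) *\<^sub>v ((incidence_mat X (k + 1))\<^sup>T *\<^sub>v v)"
proof -
  have "(boundary_mat X (k + 1))\<^sup>T
      = weight_mat X (k + 1) * ((incidence_mat X (k + 1))\<^sup>T * weight_mat_inv X k)"
    by (simp add: boundary_mat_def transpose_weight_mat transpose_weight_mat_inv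
        transpose_mult[OF mult_carrier_mat[OF weight_mat_carrier(2) incidence_mat_succ_carrier]
          weight_mat_carrier(1)]
        transpose_mult[OF weight_mat_carrier(2) incidence_mat_succ_carrier])
  then show ?thesis
    using v by (simp add: mult_mat_mat_vec weight_mat_vec_inverse[OF X])
qed

text \<open>By this adjointness, the normal equation is the stated condition multiplied by
  \<open>weight_mat X (k + 1)\<close>, which is invertible.\<close>

lemma boundary_least_squares_iff:
  assumes X: "oriented_weighted_complex X"
    and s: "s \<in> carrier_vec (num_simplices X k)" and \<beta>: "\<beta> \<in> carrier_vec (num_simplices X (k + 1))"
  shows "is_arg_min (\<lambda>\<beta>. weighted_sqnorm X k (boundary_mat X (k + 1) *\<^sub>v \<beta> - s))
      (\<lambda>\<beta>. \<beta> \<in> carrier_vec (num_simplices X (k + 1))) \<beta> \<longleftrightarrow>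
    (incidence_mat X (k + 1))\<^sup>T *\<^sub>v (boundary_mat X (k + 1) *\<^sub>v \<beta> - s) = 0\<^sub>v (num_simplices X (k + 1))"
    (is "?min \<longleftrightarrow> ?c = _")
proof -
  have E: "boundary_mat X (k + 1) \<in> carrier_mat (num_simplices X k) (num_simplices X (k + 1))"
    by (rule carrier_matI) simp_all
  have r: "boundary_mat X (k + 1) *\<^sub>v \<beta> - s \<in> carrier_vec (num_simplices X k)"
    using s by simp
  have c: "?c \<in> carrier_vec (num_simplices X (k + 1))" by simp
  have "?min \<longleftrightarrow> weight_mat X (k + 1) *\<^sub>v ?c = 0\<^sub>v (num_simplices X (k + 1))"
    using weighted_least_squares_normal_equation[OF E weight_mat_carrier(1) transpose_weight_mat
        weighted_sqnorm_nonneg[OF X, unfolded weighted_sqnorm_def] s \<beta>]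
    by (simp add: weighted_sqnorm_def transpose_boundary_mat_weight[OF X r])
  also have "\<dots> \<longleftrightarrow> ?c = 0\<^sub>v (num_simplices X (k + 1))"
  proof
    assume "weight_mat X (k + 1) *\<^sub>v ?c = 0\<^sub>v (num_simplices X (k + 1))"
    with weight_mat_vec_inverse(2)[OF X c] show "?c = 0\<^sub>v (num_simplices X (k + 1))"
      by simp
  qed simp
  finally show ?thesis .
qed

theorem theorem6:
  fixes X :: "'a weighted_complex" and k :: int and s \<alpha>\<^sub>0 \<beta>\<^sub>0 :: "real vec"
  assumes "oriented_weighted_complex X"
    and "0 \<le> k" and "k \<le> complex_dim X"
    and "s \<in> carrier_vec (num_simplices X k)"
    and "\<alpha>\<^sub>0 \<in> carrier_vec (num_simplices X (k - 1))"
    and "\<beta>\<^sub>0 \<in> carrier_vec (num_simplices X (k + 1))"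
  shows
    "((\<exists>s\<^sub>H \<in> mat_kernel (hodge_laplacian X k).
         s = (incidence_mat X k)\<^sup>T *\<^sub>v \<alpha>\<^sub>0 + s\<^sub>H
           + (weight_mat_inv X k * incidence_mat X (k + 1) * weight_mat X (k + 1)) *\<^sub>v \<beta>\<^sub>0)
      \<longleftrightarrow>
      (up_laplacian X (k - 1) *\<^sub>v \<alpha>\<^sub>0
         = (weight_mat_inv X (k - 1) * incidence_mat X k * weight_mat X k) *\<^sub>v s
       \<and> down_laplacian X (k + 1) *\<^sub>v \<beta>\<^sub>0 = (incidence_mat X (k + 1))\<^sup>T *\<^sub>v s))
     \<and>
     ((up_laplacian X (k - 1) *\<^sub>v \<alpha>\<^sub>0
         = (weight_mat_inv X (k - 1) * incidence_mat X k * weight_mat X k) *\<^sub>v s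
       \<and> down_laplacian X (k + 1) *\<^sub>v \<beta>\<^sub>0 = (incidence_mat X (k + 1))\<^sup>T *\<^sub>v s)
      \<longleftrightarrow>
      (is_arg_min (\<lambda>\<alpha>. weighted_sqnorm X k (coboundary_mat X k *\<^sub>v \<alpha> - s))
         (\<lambda>\<alpha>. \<alpha> \<in> carrier_vec (num_simplices X (k - 1))) \<alpha>\<^sub>0
       \<and> is_arg_min (\<lambda>\<beta>. weighted_sqnorm X k (boundary_mat X (k + 1) *\<^sub>v \<beta> - s))
         (\<lambda>\<beta>. \<beta> \<in> carrier_vec (num_simplices X (k + 1))) \<beta>\<^sub>0))"
proof -
  note X = assms(1) and s = assms(4) and \<alpha> = assms(5) and \<beta> = assms(6)
  let ?B = "incidence_mat X k" and ?C = "incidence_mat X (k + 1)" and ?W = "weight_mat X k"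
  let ?n = "num_simplices X k" and ?m = "num_simplices X (k - 1)" and ?p = "num_simplices X (k + 1)"
  define x where "x = ?B\<^sup>T *\<^sub>v \<alpha>\<^sub>0"
  define y where "y = boundary_mat X (k + 1) *\<^sub>v \<beta>\<^sub>0"
  have x: "x \<in> carrier_vec ?n" and y: "y \<in> carrier_vec ?n"
    by (simp_all add: x_def y_def)
  \<comment> \<open>The boundary part \<open>y\<close> is orthogonal to the image of
    \<open>?B\<^sup>T\<close> in the inner product given by \<open>?W\<close>; the next fact is the
    mirror image for \<open>x\<close>.\<close>
  have BWy: "?B *\<^sub>v (?W *\<^sub>v y) = 0\<^sub>v ?m"
  proof -
    have "?B *\<^sub>v (?W *\<^sub>v y) = (?B * ?C) *\<^sub>v (weight_mat X (k + 1) *\<^sub>v \<beta>\<^sub>0)"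
      using \<beta> by (simp add: y_def boundary_mat_mult_vec mult_mat_mat_vec weight_mat_vec_inverse[OF X])
    then show ?thesis
      by (simp add: incidence_mat_comp[OF X] mult_zero_mat_vec)
  qed
  have Cx: "?C\<^sup>T *\<^sub>v x = 0\<^sub>v ?p"
  proof -
    have "?C\<^sup>T *\<^sub>v x = (?B * ?C)\<^sup>T *\<^sub>v \<alpha>\<^sub>0"
      using \<alpha> transpose_mult[OF incidence_mat_carrier incidence_mat_succ_carrier, of X k]
      by (simp add: x_def mult_mat_mat_vec)
    then show ?thesis
      using \<alpha> by (simp add: incidence_mat_comp[OF X] mult_zero_mat_vec)
  qed
  \<comment> \<open>The only possible harmonic part, which reduces the existential statement in (1)
    to a condition on \<open>r\<close>.\<close>
  define r where "r = s - x - y"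
  have r: "r \<in> carrier_vec ?n" using s x y by (simp add: r_def)
  \<comment> \<open>The contribution of \<open>y\<close> drops out by \<open>BWy\<close>, so this
    condition on \<open>r\<close> involves \<alpha> alone; likewise \<open>Cr\<close> involves
    \<beta> alone.\<close>
  have BW: "?B *\<^sub>v (?W *\<^sub>v r) = - (?B *\<^sub>v (?W *\<^sub>v (x - s)))"
  proof -
    have W_minus: "?W *\<^sub>v (u - v) = ?W *\<^sub>v u - ?W *\<^sub>v v"
      if "u \<in> carrier_vec ?n" "v \<in> carrier_vec ?n" for u v
      using mult_minus_distrib_mat_vec[OF weight_mat_carrier(1) that] .
    have B_minus: "?B *\<^sub>v (u - v) = ?B *\<^sub>v u - ?B *\<^sub>v v"
      if "u \<in> carrier_vec ?n" "v \<in> carrier_vec ?n" for u v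
      using mult_minus_distrib_mat_vec[OF incidence_mat_carrier that] .
    have W: "?W *\<^sub>v u \<in> carrier_vec ?n" for u by simp
    show ?thesis
      using s x y W by (auto simp: r_def W_minus B_minus BWy intro!: eq_vecI)
  qed
  have Cr: "?C\<^sup>T *\<^sub>v r = - (?C\<^sup>T *\<^sub>v (y - s))"
  proof -
    have C_minus: "?C\<^sup>T *\<^sub>v (u - v) = ?C\<^sup>T *\<^sub>v u - ?C\<^sup>T *\<^sub>v v"
      if "u \<in> carrier_vec ?n" "v \<in> carrier_vec ?n" for u v
      using that by (intro mult_minus_distrib_mat_vec[of _ ?p ?n]) simp_all
    show ?thesis
      using s x y by (auto simp: r_def C_minus Cx intro!: eq_vecI)
  qed
  have L: "hodge_laplacian X k \<in> carrier_mat ?n ?n" by (simp add: hodge_laplacian_def)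
  have uminus_0: "- v = 0\<^sub>v n \<longleftrightarrow> v = 0\<^sub>v n" for v :: "real vec" and n
    by (metis uminus_uminus_vec uminus_zero_vec)
  have "s = x + h + y \<longleftrightarrow> h = r" if "h \<in> carrier_vec ?n" for h
    using that s x y by (auto simp: r_def vec_eq_iff algebra_simps)
  then have "(\<exists>h \<in> mat_kernel (hodge_laplacian X k). s = x + h + y) \<longleftrightarrow> hodge_laplacian X k *\<^sub>v r = 0\<^sub>v ?n"
    using r unfolding mat_kernel[OF L] by blast
  also have "\<dots> \<longleftrightarrow> ?B *\<^sub>v (?W *\<^sub>v (x - s)) = 0\<^sub>v ?m \<and> ?C\<^sup>T *\<^sub>v (y - s) = 0\<^sub>v ?p"
    unfolding hodge_kernel_iff[OF X r] BW Cr uminus_0 ..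
  \<comment> \<open>(2) and (3) rewrite to the same two orthogonality conditions that (1) has been
    reduced to.\<close>
  finally show ?thesis
    unfolding up_laplacian_equation_iff[OF X s \<alpha>] down_laplacian_equation_iff[OF s \<beta>]
      coboundary_least_squares_iff[OF X s \<alpha>] boundary_least_squares_iff[OF X s \<beta>]
    by (simp add: x_def y_def boundary_mat_def)
qed
end
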